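(* For any nonempty subsets $A,B\subseteq S(n)$, $$\log|M|\ \ge\ \tfrac12\log|A|+\tfrac12\log|B|+\tfrac{K}{8}\,\mathrm{d}(A,B)^2,\qquad K=\frac{4\log 2}{(n-1)^2},$$ where $M$ is the midpoint set of $A$ and $B$.
   Context: $S(n)$ is the symmetric group on $\{1,\dots,n\}$ ($n\ge 2$), equipped with the graph distance $\mathrm{d}$ of its Cayley graph generated by all transpositions ($\{a,b\}$ is an edge iff $a^{-1}b$ is a transposition); equivalently $\mathrm{d}(a,b)=n-(\text{number of cycles of }a^{-1}b)$. A permutation $m$ is a midpoint of $a$ and $b$ if $\mathrm{d}(a,m)+\mathrm{d}(m,b)=\mathrm{d}(a,b)$ and $\mathrm{d}(a,m)-\mathrm{d}(m,b)\in\{-1,0,1\}$. The midpoint set of $A$ and $B$ is $M=\{m\in S(n): m\text{ is a midpoint of some }a\in A\text{ and }b\in B\}$. $\mathrm{d}(A,B)=\min\{\mathrm{d}(a,b):a\in A,\,b\in B\}$. $|\cdot|$ denotes cardinality. *)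

theory Defs
  imports Complex_Main "HOL-Combinatorics.Permutations"
begin

definition Sym :: "nat \<Rightarrow> (nat \<Rightarrow> nat) set" where
  "Sym n = {p. p permutes {1..n}}"

definition is_transposition :: "nat \<Rightarrow> (nat \<Rightarrow> nat) \<Rightarrow> bool" where
  "is_transposition n t \<longleftrightarrow> (\<exists>i\<in>{1..n}. \<exists>j\<in>{1..n}. i \<noteq> j \<and> t = transpose i j)"

definition cayley_edges :: "nat \<Rightarrow> ((nat \<Rightarrow> nat) \<times> (nat \<Rightarrow> nat)) set" where
  "cayley_edges n = {(a, b). a \<in> Sym n \<and> b \<in> Sym n \<and> is_transposition n (inv a \<circ> b)}"

text \<open>Graph distance: the least length of a walk from \<open>a\<close> to \<open>b\<close>. The Cayley graph is
  connected, so the minimum exists for all \<open>a\<close>, \<open>b\<close> in \<open>Sym n\<close>.\<close>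
definition sdist :: "nat \<Rightarrow> (nat \<Rightarrow> nat) \<Rightarrow> (nat \<Rightarrow> nat) \<Rightarrow> nat" where
  "sdist n a b = (LEAST k. (a, b) \<in> cayley_edges n ^^ k)"

definition is_midpoint ::
  "nat \<Rightarrow> (nat \<Rightarrow> nat) \<Rightarrow> (nat \<Rightarrow> nat) \<Rightarrow> (nat \<Rightarrow> nat) \<Rightarrow> bool" where
  "is_midpoint n a b m \<longleftrightarrow>
     sdist n a m + sdist n m b = sdist n a b \<and>
     int (sdist n a m) - int (sdist n m b) \<in> {-1, 0, 1}"

definition midpoint_set :: "nat \<Rightarrow> (nat \<Rightarrow> nat) set \<Rightarrow> (nat \<Rightarrow> nat) set \<Rightarrow> (nat \<Rightarrow> nat) set" where
  "midpoint_set n A B = {m \<in> Sym n. \<exists>a\<in>A. \<exists>b\<in>B. is_midpoint n a b m}"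

definition set_sdist :: "nat \<Rightarrow> (nat \<Rightarrow> nat) set \<Rightarrow> (nat \<Rightarrow> nat) set \<Rightarrow> nat" where
  "set_sdist n A B = Min {sdist n a b | a b. a \<in> A \<and> b \<in> B}"

end

theory Submission
  imports Defs
begin

text \<open>
  Every \<open>c \<in> Sym n\<close> is uniquely a product \<open>t\<^sub>1 \<dots> t\<^sub>r\<close> of transpositions \<open>t\<^sub>k = (i\<^sub>k j\<^sub>k)\<close> with
  \<open>i\<^sub>k < j\<^sub>k\<close> and \<open>j\<^sub>1 < \<dots> < j\<^sub>r\<close>, and \<open>r\<close> is the distance from \<open>id\<close> to \<open>c\<close>. Let
  \<open>u = t\<^sub>1 t\<^sub>3 \<dots>\<close> and \<open>w = t\<^sub>2 t\<^sub>4 \<dots>\<close>. Both are midpoints of \<open>id\<close> and \<open>c\<close>. The quotient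
  \<open>u\<^sup>-\<^sup>1 w\<close> has the same sign as \<open>c\<close>, so it tells whether \<open>t\<^sub>r\<close> is its first or its last factor; as
  \<open>j\<^sub>r\<close> is the largest point moved, \<open>t\<^sub>r\<close> and then inductively all of \<open>c\<close> can be read off from it.

  Hence \<open>(a, b) \<mapsto> (a u, a w)\<close>, with \<open>c = a\<^sup>-\<^sup>1 b\<close>, is an injection of \<open>Sym n \<times> Sym n\<close> into itself
  whose components are midpoints of \<open>a\<close> and \<open>b\<close>. It maps \<open>A \<times> B \<union> B \<times> A\<close> into \<open>M \<times> M\<close>, so
  \<open>|M|\<^sup>2 \<ge> |A| |B|\<close>, and \<open>|M|\<^sup>2 \<ge> 2 |A| |B|\<close> if \<open>A\<close> and \<open>B\<close> are disjoint. Since distances are at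
  most \<open>n - 1\<close>, the curvature term is at most \<open>(ln 2) / 2\<close>, and it vanishes unless \<open>A\<close> and \<open>B\<close> are
  disjoint.
\<close>

text \<open>Permutations are manipulated as compositions; unfolding them pointwise defeats \<open>o_assoc\<close>.\<close>

declare comp_apply [simp del] id_apply [simp del] One_nat_def [simp del]

section \<open>Factorizations into transpositions and their halves\<close>

text \<open>
  This is \<open>id\<close> if \<open>c\<close> fixes \<open>n\<close>; for \<open>c \<in> Sym n\<close>, \<open>c \<circ> last_swap n c\<close> fixes \<open>n\<close>.
\<close>

definition last_swap :: "nat \<Rightarrow> (nat \<Rightarrow> nat) \<Rightarrow> nat \<Rightarrow> nat" where
  "last_swap n c = transpose (inv c n) n"

text \<open>The number \<open>r\<close> of factors, split off from the last one downwards; a stage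
  whose point is already fixed contributes none.\<close>

fun swap_length :: "nat \<Rightarrow> (nat \<Rightarrow> nat) \<Rightarrow> nat" where
  "swap_length 0 c = 0"
| "swap_length (Suc n) c =
     (if c (Suc n) = Suc n then 0 else 1) + swap_length n (c \<circ> last_swap (Suc n) c)"

text \<open>An even \<open>c \<circ> t\<close> has an even number of factors, so a nontrivial
  \<open>t\<close> has odd index and belongs to \<open>u\<close>. For \<open>t = id\<close> both
  branches agree. The sign is tested because it can be recovered from \<open>u\<close> and
  \<open>w\<close>.\<close>

fun halves :: "nat \<Rightarrow> (nat \<Rightarrow> nat) \<Rightarrow> (nat \<Rightarrow> nat) \<times> (nat \<Rightarrow> nat)" where
  "halves 0 c = (id, id)"
| "halves (Suc n) c =
     (let t = last_swap (Suc n) c; (u, w) = halves n (c \<circ> t)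
      in if evenperm (c \<circ> t) then (u \<circ> t, w) else (u, w \<circ> t))"

text \<open>Factorizations of any shape, neither ordered nor shortest: they label the walks of
  length \<open>k\<close> in the Cayley graph.\<close>

inductive swap_product :: "nat \<Rightarrow> nat \<Rightarrow> (nat \<Rightarrow> nat) \<Rightarrow> bool" for n where
  id: "swap_product n 0 id"
| comp: "swap_product n k c \<Longrightarrow> i \<in> {1..n} \<Longrightarrow> j \<in> {1..n} \<Longrightarrow> i \<noteq> j
    \<Longrightarrow> swap_product n (Suc k) (c \<circ> transpose i j)"

section \<open>Splitting off the last factor\<close>

lemma transpose_conj:
  assumes "inj t"
  shows "t \<circ> transpose i j = transpose (t i) (t j) \<circ> t"
  using assms by (auto simp: fun_eq_iff transpose_def inj_eq comp_apply)

lemma permutes_inv_image_in: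
  assumes "c permutes {1..Suc n}"
  shows "inv c (Suc n) \<in> {1..Suc n}"
  using assms permutes_in_image[OF permutes_inv[OF assms], of "Suc n"] by simp

lemma last_swap_permutes:
  assumes "c permutes {1..Suc n}"
  shows "last_swap (Suc n) c permutes {1..Suc n}"
  unfolding last_swap_def using permutes_inv_image_in[OF assms] by (intro permutes_swap_id) auto

lemma last_swap_eq_id_iff:
  assumes "c permutes {1..Suc n}"
  shows "last_swap (Suc n) c = id \<longleftrightarrow> c (Suc n) = Suc n"
  unfolding last_swap_def using permutes_inverses[OF assms] by (metis transpose_apply_first transpose_same id_apply)

lemma permutes_restrict:
  assumes "c permutes {1..Suc n}" "c (Suc n) = Suc n"
  shows "c permutes {1..n}"
proof (rule permutes_superset[OF assms(1)])
  fix x assume "x \<in> {1..Suc n} - {1..n}"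
  then have "x = Suc n" by auto
  then show "c x = x" using assms(2) by simp
qed

lemma permutes_fixes_Suc: "c permutes {1..n} \<Longrightarrow> c (Suc n) = Suc n" for n :: nat
  by (simp add: permutes_not_in)

lemma comp_last_swap_permutes:
  assumes "c permutes {1..Suc n}"
  shows "c \<circ> last_swap (Suc n) c permutes {1..n}"
proof (rule permutes_restrict)
  show "c \<circ> last_swap (Suc n) c permutes {1..Suc n}"
    using assms last_swap_permutes permutes_compose by blast
  show "(c \<circ> last_swap (Suc n) c) (Suc n) = Suc n"
    by (simp add: last_swap_def permutes_inverses[OF assms] comp_apply)
qed

lemma last_swap_involutory [simp]: "last_swap n c \<circ> last_swap n c = id"
  by (simp add: last_swap_def)

lemma comp_transpose_inv:
  assumes "c permutes S"
  shows "inv (c \<circ> transpose a b) x = transpose a b (inv c x)"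
  using assms by (simp add: o_inv_distrib permutes_bij comp_apply)

section \<open>The number of factors is minimal\<close>

lemma swap_length_id: "swap_length n id = 0"
  by (induction n) (auto simp: last_swap_def id_apply)

text \<open>The extra transposition is pushed to the left past the last factor, where it is again a
  transposition or disappears; then induction applies. Consequently no factorization is shorter than
  \<open>swap_length\<close>.\<close>

lemma swap_length_comp_transpose_le:
  assumes "c permutes {1..n}" "a \<in> {1..n}" "b \<in> {1..n}"
  shows "swap_length n (c \<circ> transpose a b) \<le> Suc (swap_length n c)"
  using assms
proof (induction n arbitrary: c a b)
  case 0
  then show ?case by simp
next
  case (Suc n)
  define N where "N = Suc n"
  define i where "i = inv c N"
  let ?c' = "c \<circ> last_swap N c"
  have c: "c permutes {1..N}" using Suc.prems N_def by simp
  have c': "?c' permutes {1..n}" using comp_last_swap_permutes Suc.prems N_def by blast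
  have iN: "i \<in> {1..N}" using permutes_inv_image_in Suc.prems unfolding i_def N_def by blast
  have ci: "c i = N" unfolding i_def by (simp add: permutes_inverses[OF c])
  have fix_iff: "c x = N \<longleftrightarrow> x = i" for x using ci c by (metis permutes_inverses(2))
  have *: "swap_length N (c \<circ> transpose a b) \<le> Suc (swap_length N c)"
    if ab: "a \<in> {1..n}" "b \<in> {1..N}" for a b
  proof (cases "b = N")
    case False
    then have b: "b \<in> {1..n}" using ab N_def by auto
    have "c \<circ> transpose a b \<circ> last_swap N (c \<circ> transpose a b)
        = c \<circ> (transpose a b \<circ> transpose (transpose a b i) N)"
      by (simp add: last_swap_def comp_transpose_inv[OF c] i_def o_assoc)
    \<comment> \<open>\<open>transpose a b\<close> fixes \<open>N\<close>, so conjugation by it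
      turns the new last factor into the old one.\<close>
    also have "transpose a b \<circ> transpose (transpose a b i) N = last_swap N c \<circ> transpose a b"
      using transpose_conj[of "transpose a b" "transpose a b i" N] False ab b N_def
      by (simp add: last_swap_def i_def)
    finally have e: "c \<circ> transpose a b \<circ> last_swap N (c \<circ> transpose a b) = ?c' \<circ> transpose a b"
      by (simp add: o_assoc)
    have "(c \<circ> transpose a b) N = c N" using False ab b N_def by (simp add: comp_apply)
    then show ?thesis using Suc.IH[OF c' ab(1) b] e unfolding N_def by auto
  next
    case True
    have aN: "a \<noteq> N" using ab N_def by auto
    have li: "last_swap N (c \<circ> transpose a b) = transpose (transpose a b i) N"
      by (simp add: last_swap_def comp_transpose_inv[OF c] i_def)
    have l: "last_swap N c = transpose i N" by (simp add: last_swap_def i_def)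
    \<comment> \<open>If \<open>i = N\<close>, the transposition becomes the last factor; if
      \<open>i = a\<close>, it cancels the last factor of \<open>c\<close>; otherwise the last
      factor is unchanged and \<open>transpose a i\<close> remains for the induction
      hypothesis.\<close>
    consider "i = N" | "i = a" | "i \<noteq> N" "i \<noteq> a" by blast
    then show ?thesis
    proof cases
      case 1
      have "c \<circ> transpose a b \<circ> last_swap N (c \<circ> transpose a b) = ?c'"
        unfolding li l using 1 True by (simp add: o_assoc[symmetric])
      then show ?thesis unfolding N_def by auto
    next
      case 2
      have "c \<circ> transpose a b \<circ> last_swap N (c \<circ> transpose a b) = ?c'"
        unfolding li l using 2 True by simp
      then show ?thesis unfolding N_def by auto
    next
      case 3
      have i: "i \<in> {1..n}" using 3 iN N_def by auto
      have "transpose a N \<circ> transpose i N = transpose i N \<circ> transpose a i"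
        using 3 aN by (auto simp: fun_eq_iff transpose_def comp_apply)
      then have "c \<circ> transpose a b \<circ> last_swap N (c \<circ> transpose a b) = ?c' \<circ> transpose a i"
        unfolding li l using 3 True by (simp add: o_assoc[symmetric])
      \<comment> \<open>Hence stage \<open>N\<close> counts one for \<open>c\<close>, which absorbs
        the one it counts on the left.\<close>
      moreover have "c N \<noteq> N" using 3 fix_iff[of N] by simp
      ultimately show ?thesis using Suc.IH[OF c' ab(1) i] unfolding N_def by auto
    qed
  qed
  consider "a \<in> {1..n}" | "b \<in> {1..n}" | "a = N" "b = N" using Suc.prems N_def by force
  then show ?case
  proof cases
    case 1
    then show ?thesis using * Suc.prems unfolding N_def by blast
  next
    case 2
    then show ?thesis using *[of b a] Suc.prems unfolding N_def by (simp add: transpose_commute)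
  next
    case 3
    then show ?thesis by simp
  qed
qed

lemma swap_product_permutes: "swap_product n k c \<Longrightarrow> c permutes {1..n}"
  by (induction rule: swap_product.induct) (auto intro!: permutes_compose permutes_swap_id permutes_id)

lemma swap_length_le_swap_product: "swap_product n k c \<Longrightarrow> swap_length n c \<le> k"
proof (induction rule: swap_product.induct)
  case id
  then show ?case by (simp add: swap_length_id)
next
  case (comp k c i j)
  then show ?case
    using swap_length_comp_transpose_le[OF swap_product_permutes[OF comp.hyps(1)], of i j] by linarith
qed

section \<open>Lengths of the two halves and of their complements\<close>

lemma swap_product_extend: "swap_product n k c \<Longrightarrow> swap_product (Suc n) k c"
  by (induction rule: swap_product.induct) (auto intro: swap_product.intros)

text \<open>A conjugate of a transposition is a transposition. This is needed because giving a new
  last factor to a half conjugates the complement of that half.\<close>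

lemma swap_product_conj:
  assumes "swap_product n k c" "t permutes {1..n}"
  shows "swap_product n k (inv t \<circ> c \<circ> t)"
  using assms(1)
proof (induction rule: swap_product.induct)
  case id
  then show ?case using assms(2) by (simp add: permutes_inv_o swap_product.id)
next
  case (comp k c i j)
  let ?s = "inv t"
  have s: "?s permutes {1..n}" using assms(2) by (rule permutes_inv)
  have "transpose i j \<circ> t = t \<circ> transpose (?s i) (?s j)"
    using transpose_conj[OF permutes_inj[OF assms(2)], of "?s i" "?s j"]
    by (simp add: permutes_inverses[OF assms(2)])
  then have "?s \<circ> (c \<circ> transpose i j) \<circ> t = (?s \<circ> c \<circ> t) \<circ> transpose (?s i) (?s j)"
    by (simp add: o_assoc[symmetric])
  moreover have "?s i \<in> {1..n}" "?s j \<in> {1..n}" "?s i \<noteq> ?s j"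
    using comp.hyps permutes_in_image[OF s] permutes_inj[OF s] by (auto simp: inj_eq)
  ultimately show ?case using comp.IH by (simp add: swap_product.comp)
qed

lemma evenperm_last_swap:
  assumes "c permutes {1..Suc n}"
  shows "evenperm (last_swap (Suc n) c) \<longleftrightarrow> c (Suc n) = Suc n"
  using last_swap_eq_id_iff[OF assms] unfolding last_swap_def
  by (metis evenperm_id evenperm_swap transpose_same)

lemma permutation_if_permutes: "c permutes {1..n} \<Longrightarrow> permutation c" for n :: nat
  by (auto simp: permutation_permutes)

lemma evenperm_comp_last_swap:
  assumes "c permutes {1..Suc n}"
  shows "evenperm (c \<circ> last_swap (Suc n) c) = (evenperm c \<longleftrightarrow> c (Suc n) = Suc n)"
  using assms last_swap_permutes[OF assms]
  by (subst evenperm_comp) (auto simp: permutation_if_permutes evenperm_last_swap)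

text \<open>Each nontrivial last factor flips the sign. This ties the sign test in
  \<open>halves\<close> to the rounding of \<open>r / 2\<close>.\<close>

lemma evenperm_iff_even_swap_length:
  "c permutes {1..n} \<Longrightarrow> evenperm c \<longleftrightarrow> even (swap_length n c)"
proof (induction n arbitrary: c)
  case 0
  then show ?case by simp
next
  case (Suc n)
  then show ?case
    using Suc.IH[OF comp_last_swap_permutes[OF Suc.prems]] evenperm_comp_last_swap[OF Suc.prems]
    by (auto simp: id_apply)
qed

text \<open>A last factor \<open>t\<close> given to one half lengthens it and merely conjugates its
  complement by \<open>t\<close>; the other half is unchanged, and its complement gains
  \<open>t\<close> on the right. So each half and its complement always have \<open>r\<close>
  factors together.\<close>

lemma swap_product_halves:
  assumes "c permutes {1..n}" "halves n c = (u, w)" "r = swap_length n c"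
  shows "swap_product n ((r + 1) div 2) u" "swap_product n (r div 2) w"
    "swap_product n (r div 2) (inv u \<circ> c)" "swap_product n ((r + 1) div 2) (inv w \<circ> c)"
proof -
  have "swap_product n ((r + 1) div 2) u \<and> swap_product n (r div 2) w \<and>
    swap_product n (r div 2) (inv u \<circ> c) \<and> swap_product n ((r + 1) div 2) (inv w \<circ> c)"
    using assms
  proof (induction n arbitrary: c u w r)
    case 0
    then show ?case by (auto intro: swap_product.id)
  next
    case (Suc n)
    define t where "t = last_swap (Suc n) c"
    define c' where "c' = c \<circ> t"
    obtain u' w' where h: "halves n c' = (u', w')" by fastforce
    define r' where "r' = swap_length n c'"
    have c': "c' permutes {1..n}"
      unfolding c'_def t_def by (rule comp_last_swap_permutes[OF Suc.prems(1)])
    have tt: "t \<circ> t = id" unfolding t_def by simp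
    have c_eq: "c = c' \<circ> t" unfolding c'_def using tt by (simp add: o_assoc[symmetric])
    have inv_t: "inv t = t" using tt by (simp add: inv_unique_comp)
    have t: "t permutes {1..Suc n}" unfolding t_def by (rule last_swap_permutes[OF Suc.prems(1)])
    have IH: "swap_product (Suc n) ((r' + 1) div 2) u'" "swap_product (Suc n) (r' div 2) w'"
      "swap_product (Suc n) (r' div 2) (inv u' \<circ> c')"
      "swap_product (Suc n) ((r' + 1) div 2) (inv w' \<circ> c')"
      using Suc.IH[OF c' h r'_def] by (auto intro: swap_product_extend)
    have bij: "bij u'" "bij w'" "bij t" using IH(1,2) t by (auto dest: swap_product_permutes permutes_bij)
    have uw: "(u, w) = (if evenperm c' then (u' \<circ> t, w') else (u', w' \<circ> t))"
      using Suc.prems(2) h by (auto simp: c'_def t_def Let_def)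
    have conj: "swap_product (Suc n) k (t \<circ> x \<circ> t)" if "swap_product (Suc n) k x" for k x
      using swap_product_conj[OF that t] inv_t by simp
    have par: "evenperm c' \<longleftrightarrow> even r'" using evenperm_iff_even_swap_length[OF c'] r'_def by simp
    show ?case
    proof (cases "c (Suc n) = Suc n")
      case True
      then have "t = id" unfolding t_def using last_swap_eq_id_iff[OF Suc.prems(1)] by blast
      moreover have "r = r'" using True Suc.prems(3) by (simp add: r'_def c'_def t_def)
      ultimately show ?thesis using IH uw c_eq by (auto split: if_splits)
    next
      case False
      have r: "r = Suc r'" using False Suc.prems(3) by (simp add: r'_def c'_def t_def)
      have step: "swap_product (Suc n) (Suc k) (x \<circ> t)" if "swap_product (Suc n) k x" for k x
        unfolding t_def last_swap_def
      proof (rule swap_product.comp[OF that])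
        show "inv c (Suc n) \<in> {1..Suc n}" by (rule permutes_inv_image_in[OF Suc.prems(1)])
        show "inv c (Suc n) \<noteq> Suc n" using False permutes_inverses[OF Suc.prems(1)] by metis
      qed simp
      show ?thesis
      proof (cases "even r'")
        case True
        then have e: "u = u' \<circ> t" "w = w'" using uw par by auto
        have "inv u \<circ> c = t \<circ> (inv u' \<circ> c') \<circ> t"
          unfolding e c_eq using bij by (simp add: o_inv_distrib inv_t o_assoc)
        moreover have "inv w \<circ> c = (inv w' \<circ> c') \<circ> t" unfolding e c_eq by (simp add: o_assoc)
        \<comment> \<open>Only the rounded-up counts grow, those of \<open>u\<close> and
          \<open>inv w \<circ> c\<close>.\<close>
        moreover have "(r + 1) div 2 = Suc (r' div 2)" "r div 2 = r' div 2" "(r' + 1) div 2 = r' div 2"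
          using True r by auto
        ultimately show ?thesis using IH conj step e by auto
      next
        case False
        then have e: "u = u'" "w = w' \<circ> t" using uw par by auto
        have "inv w \<circ> c = t \<circ> (inv w' \<circ> c') \<circ> t"
          unfolding e c_eq using bij by (simp add: o_inv_distrib inv_t o_assoc)
        moreover have "inv u \<circ> c = (inv u' \<circ> c') \<circ> t" unfolding e c_eq by (simp add: o_assoc)
        \<comment> \<open>Here the rounded-down counts grow, those of \<open>w\<close> and
          \<open>inv u \<circ> c\<close>.\<close>
        moreover have "(r + 1) div 2 = Suc (r' div 2)" "r div 2 = Suc (r' div 2)"
          "(r' + 1) div 2 = Suc (r' div 2)"
          using False r by auto
        ultimately show ?thesis using IH conj step e by auto
      qed
    qed
  qed
  then show "swap_product n ((r + 1) div 2) u" "swap_product n (r div 2) w"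
    "swap_product n (r div 2) (inv u \<circ> c)" "swap_product n ((r + 1) div 2) (inv w \<circ> c)"
    by auto
qed

section \<open>Recovering a permutation from the quotient of its halves\<close>

text \<open>A common left factor \<open>a\<close> cancels in the quotient of
  \<open>a \<circ> u\<close> and \<open>a \<circ> w\<close>, so the two midpoints reveal this
  permutation before \<open>a\<close> is known.\<close>

definition halves_quotient :: "nat \<Rightarrow> (nat \<Rightarrow> nat) \<Rightarrow> nat \<Rightarrow> nat" where
  "halves_quotient n c = inv (fst (halves n c)) \<circ> snd (halves n c)"

lemma halves_permute:
  assumes "c permutes {1..n}"
  shows "fst (halves n c) permutes {1..n}" "snd (halves n c) permutes {1..n}"
  using swap_product_halves(1,2)[OF assms, of "fst (halves n c)" "snd (halves n c)"]
  by (auto dest: swap_product_permutes)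

lemma halves_quotient_permutes:
  assumes "c permutes {1..n}"
  shows "halves_quotient n c permutes {1..n}"
  unfolding halves_quotient_def using halves_permute[OF assms]
  by (intro permutes_compose permutes_inv)

text \<open>Inversion moves the last factor of \<open>u\<close> to the front, while that of
  \<open>w\<close> stays at the back: the newest factor is always outermost.\<close>

lemma halves_quotient_Suc:
  assumes "c permutes {1..Suc n}"
  defines "t \<equiv> last_swap (Suc n) c"
  shows "halves_quotient (Suc n) c =
    (if evenperm (c \<circ> t) then t \<circ> halves_quotient n (c \<circ> t) else halves_quotient n (c \<circ> t) \<circ> t)"
proof -
  have "inv t = t" unfolding t_def by (simp add: inv_unique_comp)
  moreover have "bij t" unfolding t_def using last_swap_permutes[OF assms(1)] by (rule permutes_bij)
  moreover have "bij (fst (halves n (c \<circ> t)))"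
    unfolding t_def using halves_permute(1)[OF comp_last_swap_permutes[OF assms(1)]] by (rule permutes_bij)
  ultimately show ?thesis
    by (auto simp: halves_quotient_def Let_def case_prod_beta o_inv_distrib o_assoc t_def[symmetric])
qed

text \<open>The quotient is a product of the same transpositions in another order.\<close>

lemma evenperm_halves_quotient:
  "c permutes {1..n} \<Longrightarrow> evenperm (halves_quotient n c) \<longleftrightarrow> evenperm c"
proof (induction n arbitrary: c)
  case 0
  then show ?case by (simp add: halves_quotient_def)
next
  case (Suc n)
  let ?t = "last_swap (Suc n) c"
  have c': "c \<circ> ?t permutes {1..n}" by (rule comp_last_swap_permutes[OF Suc.prems])
  have "permutation ?t" "permutation (halves_quotient n (c \<circ> ?t))"
    using last_swap_permutes[OF Suc.prems] halves_quotient_permutes[OF c']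
    by (auto intro: permutation_if_permutes)
  then have "evenperm (halves_quotient (Suc n) c) \<longleftrightarrow> (evenperm (c \<circ> ?t) \<longleftrightarrow> c (Suc n) = Suc n)"
    by (auto simp: halves_quotient_Suc[OF Suc.prems] evenperm_comp Suc.IH[OF c']
        evenperm_last_swap[OF Suc.prems])
  then show ?case using evenperm_comp_last_swap[OF Suc.prems] by auto
qed

text \<open>The inner quotient fixes \<open>Suc n\<close>, so only the outermost \<open>t\<close>
  moves this point, and \<open>d\<close> or its inverse shows where. On which side \<open>t\<close>
  stands depends on the sign of \<open>c \<circ> t\<close>, which \<open>d\<close> determines
  too.\<close>

lemma halves_quotient_recovers_swap:
  assumes "c permutes {1..Suc n}"
  defines "t \<equiv> last_swap (Suc n) c" and "d \<equiv> halves_quotient (Suc n) c"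
  shows "inv c (Suc n) = (if evenperm (c \<circ> t) then d (Suc n) else inv d (Suc n))"
    and "evenperm (c \<circ> t) = (evenperm d \<longleftrightarrow> d (Suc n) = Suc n)"
proof -
  let ?d' = "halves_quotient n (c \<circ> t)"
  have d': "?d' permutes {1..n}" unfolding t_def
    by (rule halves_quotient_permutes[OF comp_last_swap_permutes[OF assms(1)]])
  have d: "d = (if evenperm (c \<circ> t) then t \<circ> ?d' else ?d' \<circ> t)"
    unfolding d_def t_def by (rule halves_quotient_Suc[OF assms(1)])
  have dp: "d permutes {1..Suc n}" unfolding d_def by (rule halves_quotient_permutes[OF assms(1)])
  have N: "?d' (Suc n) = Suc n" by (rule permutes_fixes_Suc[OF d'])
  have tN: "t (Suc n) = inv c (Suc n)" "t (inv c (Suc n)) = Suc n" by (simp_all add: t_def last_swap_def)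
  show inv: "inv c (Suc n) = (if evenperm (c \<circ> t) then d (Suc n) else inv d (Suc n))"
  proof (cases "evenperm (c \<circ> t)")
    case False
    then have "d (inv c (Suc n)) = Suc n" using d N tN by (simp add: comp_apply)
    then show ?thesis using False permutes_inverses(2)[OF dp] by metis
  qed (simp add: d N tN comp_apply)
  \<comment> \<open>Both \<open>c\<close> and \<open>d\<close> fix \<open>Suc n\<close> exactly when
    \<open>t\<close> is trivial; with the equal signs of \<open>c\<close> and \<open>d\<close> this
    gives the sign of \<open>c \<circ> t\<close>.\<close>
  have "c (Suc n) = Suc n \<longleftrightarrow> inv c (Suc n) = Suc n" using permutes_inverses[OF assms(1)] by metis
  also have "\<dots> \<longleftrightarrow> d (Suc n) = Suc n" using inv permutes_inverses[OF dp] by metis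
  finally show "evenperm (c \<circ> t) = (evenperm d \<longleftrightarrow> d (Suc n) = Suc n)"
    using evenperm_comp_last_swap[OF assms(1)] evenperm_halves_quotient[OF assms(1)]
    unfolding t_def d_def by simp
qed

text \<open>Equal quotients have the same outermost factor on the same side; it cancels, and the
  quotients of the shorter products agree.\<close>

lemma halves_quotient_inj:
  "c permutes {1..n} \<Longrightarrow> c' permutes {1..n} \<Longrightarrow> halves_quotient n c = halves_quotient n c' \<Longrightarrow> c = c'"
proof (induction n arbitrary: c c')
  case 0
  then show ?case by simp
next
  case (Suc n)
  note rec = halves_quotient_recovers_swap[OF Suc.prems(1)] halves_quotient_recovers_swap[OF Suc.prems(2)]
  define t where "t = last_swap (Suc n) c"
  have even: "evenperm (c \<circ> t) = evenperm (c' \<circ> last_swap (Suc n) c')"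
    unfolding t_def using rec Suc.prems(3) by simp
  have "inv c (Suc n) = inv c' (Suc n)" using rec Suc.prems(3) even unfolding t_def by simp
  then have t': "last_swap (Suc n) c' = t" by (simp add: last_swap_def t_def)
  have tt: "t \<circ> t = id" unfolding t_def by simp
  have "halves_quotient n (c \<circ> t) = halves_quotient n (c' \<circ> t)"
  proof (cases "evenperm (c \<circ> t)")
    case True
    then have "t \<circ> halves_quotient n (c \<circ> t) = t \<circ> halves_quotient n (c' \<circ> t)"
      using Suc.prems(3) halves_quotient_Suc[OF Suc.prems(1)] halves_quotient_Suc[OF Suc.prems(2)] even t'
      by (simp add: t_def[symmetric])
    then show ?thesis using tt by (metis comp_assoc id_comp)
  next
    case False
    then have "halves_quotient n (c \<circ> t) \<circ> t = halves_quotient n (c' \<circ> t) \<circ> t"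
      using Suc.prems(3) halves_quotient_Suc[OF Suc.prems(1)] halves_quotient_Suc[OF Suc.prems(2)] even t'
      by (simp add: t_def[symmetric])
    then show ?thesis using tt by (metis comp_assoc comp_id)
  qed
  then have "c \<circ> t = c' \<circ> t"
    using Suc.IH comp_last_swap_permutes[OF Suc.prems(1)] comp_last_swap_permutes[OF Suc.prems(2)] t' t_def
    by metis
  then show ?case using tt by (metis comp_assoc comp_id)
qed

section \<open>Factorizations as walks, and a criterion for midpoints\<close>

lemma relpow_cayley_edges_if_swap_product:
  assumes "swap_product n k c" "a \<in> Sym n"
  shows "(a, a \<circ> c) \<in> cayley_edges n ^^ k"
  using assms(1)
proof (induction rule: swap_product.induct)
  case id
  then show ?case by simp
next
  case (comp k c i j)
  have a: "a permutes {1..n}" using assms(2) by (simp add: Sym_def)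
  have ac: "a \<circ> c permutes {1..n}" using comp.hyps a by (auto intro: permutes_compose swap_product_permutes)
  have "a \<circ> c \<circ> transpose i j permutes {1..n}"
    using ac comp.hyps(2,3) by (intro permutes_compose[OF permutes_swap_id])
  moreover have "inv (a \<circ> c) \<circ> (a \<circ> c \<circ> transpose i j) = transpose i j"
    using permutes_inv_o(2)[OF ac] by (simp add: o_assoc)
  moreover have "is_transposition n (transpose i j)"
    using comp.hyps unfolding is_transposition_def by blast
  ultimately have "(a \<circ> c, a \<circ> (c \<circ> transpose i j)) \<in> cayley_edges n"
    using ac by (simp add: cayley_edges_def Sym_def o_assoc)
  then show ?case using comp.IH by auto
qed

lemma swap_product_if_relpow_cayley_edges:
  assumes "(a, b) \<in> cayley_edges n ^^ k" "a \<in> Sym n"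
  shows "swap_product n k (inv a \<circ> b)"
  using assms
proof (induction k arbitrary: b)
  case 0
  then show ?case using permutes_inv_o(2)[of a "{1..n}"] by (auto simp: Sym_def intro: swap_product.id)
next
  case (Suc k)
  then obtain m where m: "(a, m) \<in> cayley_edges n ^^ k" "(m, b) \<in> cayley_edges n" by auto
  then obtain i j where ij: "i \<in> {1..n}" "j \<in> {1..n}" "i \<noteq> j" "inv m \<circ> b = transpose i j"
    and mp: "m permutes {1..n}"
    by (auto simp: cayley_edges_def is_transposition_def Sym_def)
  have "inv a \<circ> b = (inv a \<circ> m) \<circ> (inv m \<circ> b)"
    using permutes_inv_o(1)[OF mp] by (metis comp_assoc comp_id)
  then show ?case using Suc.IH[OF m(1) Suc.prems(2)] ij by (auto intro: swap_product.comp)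
qed

lemma sdist_le: "(a, b) \<in> cayley_edges n ^^ k \<Longrightarrow> sdist n a b \<le> k"
  unfolding sdist_def by (rule Least_le)

lemma sdist_relpow: "(a, b) \<in> cayley_edges n ^^ k \<Longrightarrow> (a, b) \<in> cayley_edges n ^^ sdist n a b"
  unfolding sdist_def by (rule LeastI)

text \<open>The walks bound the two distances by \<open>p\<close> and \<open>q\<close>; the triangle
  inequality forces equality, since \<open>p + q\<close> is the full distance.\<close>

lemma is_midpointI:
  assumes "(a, m) \<in> cayley_edges n ^^ p" "(m, b) \<in> cayley_edges n ^^ q"
    and "sdist n a b = p + q" "int p - int q \<in> {-1, 0, 1}"
  shows "is_midpoint n a b m"
proof -
  have "(a, b) \<in> cayley_edges n ^^ (sdist n a m + sdist n m b)"
    using sdist_relpow[OF assms(1)] sdist_relpow[OF assms(2)] by (auto simp: relpow_add)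
  then have "p + q \<le> sdist n a m + sdist n m b" using sdist_le assms(3) by metis
  moreover have "sdist n a m \<le> p" "sdist n m b \<le> q" using assms by (auto intro: sdist_le)
  ultimately have "sdist n a m = p" "sdist n m b = q" by auto
  then show ?thesis using assms unfolding is_midpoint_def by simp
qed

section \<open>The injection into pairs of midpoints\<close>

definition midpoint_pair ::
  "nat \<Rightarrow> (nat \<Rightarrow> nat) \<times> (nat \<Rightarrow> nat) \<Rightarrow> (nat \<Rightarrow> nat) \<times> (nat \<Rightarrow> nat)" where
  "midpoint_pair n = (\<lambda>(a, b). (a \<circ> fst (halves n (inv a \<circ> b)), a \<circ> snd (halves n (inv a \<circ> b))))"

lemma inv_comp_permutes:
  assumes "a \<in> Sym n" "b \<in> Sym n"
  shows "inv a \<circ> b permutes {1..n}"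
  using assms by (auto simp: Sym_def intro: permutes_compose permutes_inv)

text \<open>The three facts share one construction: walks through \<open>a \<circ> u\<close> and
  \<open>a \<circ> w\<close> of total length \<open>r\<close>, split as evenly as possible.\<close>

lemma sdist_eq_and_midpoint_pair:
  assumes "a \<in> Sym n" "b \<in> Sym n"
  shows sdist_eq_swap_length: "sdist n a b = swap_length n (inv a \<circ> b)"
    and is_midpoint_fst_midpoint_pair: "is_midpoint n a b (fst (midpoint_pair n (a, b)))"
    and is_midpoint_snd_midpoint_pair: "is_midpoint n a b (snd (midpoint_pair n (a, b)))"
proof -
  define c where "c = inv a \<circ> b"
  define r where "r = swap_length n c"
  obtain u w where h: "halves n c = (u, w)" by fastforce
  have ap: "a permutes {1..n}" using assms Sym_def by auto
  have c: "c permutes {1..n}" unfolding c_def by (rule inv_comp_permutes[OF assms])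
  have b: "b = a \<circ> c" unfolding c_def using permutes_inv_o(1)[OF ap] by (simp add: o_assoc)
  note sp = swap_product_halves[OF c h r_def]
  have S: "a \<circ> u \<in> Sym n" "a \<circ> w \<in> Sym n"
    using ap sp(1,2) by (auto simp: Sym_def intro: permutes_compose swap_product_permutes)
  have cancel: "a \<circ> x \<circ> (inv x \<circ> c) = b" if "x permutes {1..n}" for x
    unfolding b using permutes_inv_o(1)[OF that] by (metis comp_assoc comp_id)
  have u: "(a, a \<circ> u) \<in> cayley_edges n ^^ ((r + 1) div 2)" "(a \<circ> u, b) \<in> cayley_edges n ^^ (r div 2)"
    using relpow_cayley_edges_if_swap_product[OF sp(1) assms(1)]
      relpow_cayley_edges_if_swap_product[OF sp(3) S(1)] cancel[OF swap_product_permutes[OF sp(1)]] by auto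
  have w: "(a, a \<circ> w) \<in> cayley_edges n ^^ (r div 2)" "(a \<circ> w, b) \<in> cayley_edges n ^^ ((r + 1) div 2)"
    using relpow_cayley_edges_if_swap_product[OF sp(2) assms(1)]
      relpow_cayley_edges_if_swap_product[OF sp(4) S(2)] cancel[OF swap_product_permutes[OF sp(2)]] by auto
  have r2: "(r + 1) div 2 + r div 2 = r" by presburger
  then have walk: "(a, b) \<in> cayley_edges n ^^ r" using u by (metis relcompI relpow_add)
  have d: "sdist n a b = r"
  proof (rule antisym)
    show "sdist n a b \<le> r" using walk by (rule sdist_le)
    \<comment> \<open>A shortest walk is itself a factorization of \<open>c\<close>, and none has
      fewer than \<open>r\<close> factors.\<close>
    show "r \<le> sdist n a b"
      using swap_product_if_relpow_cayley_edges[OF sdist_relpow[OF walk] assms(1)]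
      unfolding r_def c_def by (rule swap_length_le_swap_product)
  qed
  then show "sdist n a b = swap_length n (inv a \<circ> b)" unfolding r_def c_def .
  have bal: "int ((r + 1) div 2) - int (r div 2) \<in> {-1, 0, 1}"
    "int (r div 2) - int ((r + 1) div 2) \<in> {-1, 0, 1}" by auto
  show "is_midpoint n a b (fst (midpoint_pair n (a, b)))"
    using is_midpointI[OF u _ bal(1)] d r2 h by (simp add: midpoint_pair_def c_def)
  show "is_midpoint n a b (snd (midpoint_pair n (a, b)))"
    using is_midpointI[OF w _ bal(2)] d r2 h by (simp add: midpoint_pair_def c_def)
qed

lemma midpoint_pair_in_Sym:
  assumes "a \<in> Sym n" "b \<in> Sym n"
  shows "midpoint_pair n (a, b) \<in> Sym n \<times> Sym n"
  using assms halves_permute[OF inv_comp_permutes[OF assms]]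
  by (auto simp: midpoint_pair_def Sym_def intro: permutes_compose)

text \<open>The quotient of the two components determines \<open>c\<close>, hence \<open>u\<close>;
  cancelling \<open>u\<close> from the first component gives \<open>a\<close>, and then
  \<open>b = a \<circ> c\<close>.\<close>

lemma inj_on_midpoint_pair: "inj_on (midpoint_pair n) (Sym n \<times> Sym n)"
proof (rule inj_onI, clarify)
  fix a b a' b'
  assume S: "a \<in> Sym n" "b \<in> Sym n" "a' \<in> Sym n" "b' \<in> Sym n"
    and eq: "midpoint_pair n (a, b) = midpoint_pair n (a', b')"
  have quot: "inv (fst (midpoint_pair n (a, b))) \<circ> snd (midpoint_pair n (a, b))
      = halves_quotient n (inv a \<circ> b)" if "a \<in> Sym n" "b \<in> Sym n" for a b
  proof -
    have "bij a" "inv a \<circ> a = id" using that(1) permutes_bij permutes_inv_o(2) by (auto simp: Sym_def)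
    moreover have "bij (fst (halves n (inv a \<circ> b)))"
      using halves_permute(1)[OF inv_comp_permutes[OF that]] by (rule permutes_bij)
    ultimately show ?thesis
      by (simp add: midpoint_pair_def halves_quotient_def o_inv_distrib) (metis comp_assoc id_comp)
  qed
  have c: "inv a \<circ> b = inv a' \<circ> b'"
    using halves_quotient_inj[OF inv_comp_permutes[OF S(1,2)] inv_comp_permutes[OF S(3,4)]]
      quot[OF S(1,2)] quot[OF S(3,4)] eq by simp
  let ?u = "fst (halves n (inv a \<circ> b))"
  have "?u permutes {1..n}" by (rule halves_permute(1)[OF inv_comp_permutes[OF S(1,2)]])
  moreover have "a \<circ> ?u = a' \<circ> ?u" using eq c by (simp add: midpoint_pair_def)
  ultimately have aa: "a = a'" by (metis comp_assoc comp_id permutes_inv_o(1))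
  have "a permutes {1..n}" using S(1) by (simp add: Sym_def)
  then have "b = b'" using c aa by (metis comp_assoc id_comp permutes_inv_o(1))
  with aa show "a = a' \<and> b = b'" by simp
qed

section \<open>Exchanging endpoints, and the counting bound\<close>

lemma sym_cayley_edges: "sym (cayley_edges n)"
proof (rule symI)
  fix a b assume ab: "(a, b) \<in> cayley_edges n"
  then have "bij a" "bij b" by (auto simp: cayley_edges_def Sym_def permutes_bij)
  then have "inv b \<circ> a = inv (inv a \<circ> b)" by (simp add: o_inv_distrib bij_imp_bij_inv inv_inv_eq)
  moreover obtain i j where "i \<in> {1..n}" "j \<in> {1..n}" "i \<noteq> j" "inv a \<circ> b = transpose i j"
    using ab by (auto simp: cayley_edges_def is_transposition_def)
  ultimately have "is_transposition n (inv b \<circ> a)"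
    unfolding is_transposition_def by (metis inv_transpose_eq)
  then show "(b, a) \<in> cayley_edges n" using ab by (simp add: cayley_edges_def)
qed

lemma sdist_commute: "sdist n a b = sdist n b a"
proof -
  have "(b, a) \<in> cayley_edges n ^^ k" if "(a, b) \<in> cayley_edges n ^^ k" for a b k
    using that
  proof (induction k arbitrary: b)
    case (Suc k)
    then obtain m where "(a, m) \<in> cayley_edges n ^^ k" "(m, b) \<in> cayley_edges n" by auto
    then show ?case using Suc.IH sym_cayley_edges by (meson relpow_Suc_I2 symD)
  qed simp
  then have "(a, b) \<in> cayley_edges n ^^ k \<longleftrightarrow> (b, a) \<in> cayley_edges n ^^ k" for k by blast
  then show ?thesis unfolding sdist_def by simp
qed

lemma is_midpoint_commute: "is_midpoint n a b m \<longleftrightarrow> is_midpoint n b a m"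
  unfolding is_midpoint_def using sdist_commute[of n a m] sdist_commute[of n m b] sdist_commute[of n a b]
  by auto

lemma finite_Sym: "finite (Sym n)"
  unfolding Sym_def by (rule finite_permutations) simp

text \<open>Midpoints do not depend on the order of the endpoints, so pairs from
  \<open>B \<times> A\<close> also land in \<open>M \<times> M\<close>. Including them yields the
  factor 2 for disjoint sets.\<close>

lemma card_product_le_card_midpoint_set:
  assumes "A \<subseteq> Sym n" "B \<subseteq> Sym n"
  shows "card (A \<times> B \<union> B \<times> A) \<le> (card (midpoint_set n A B))\<^sup>2"
proof -
  let ?M = "midpoint_set n A B"
  have fin: "finite ?M" by (rule finite_subset[OF _ finite_Sym]) (auto simp: midpoint_set_def)
  have sub: "A \<times> B \<union> B \<times> A \<subseteq> Sym n \<times> Sym n" using assms by auto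
  have "midpoint_pair n (x, y) \<in> ?M \<times> ?M" if xy: "(x, y) \<in> A \<times> B \<union> B \<times> A" for x y
  proof -
    have S: "x \<in> Sym n" "y \<in> Sym n" using xy assms by auto
    have "m \<in> ?M" if "m \<in> Sym n" "is_midpoint n x y m" for m
      using that xy is_midpoint_commute unfolding midpoint_set_def by blast
    then show ?thesis
      using midpoint_pair_in_Sym[OF S] is_midpoint_fst_midpoint_pair[OF S]
        is_midpoint_snd_midpoint_pair[OF S] by (simp add: mem_Times_iff)
  qed
  then have "midpoint_pair n ` (A \<times> B \<union> B \<times> A) \<subseteq> ?M \<times> ?M" by blast
  then have "card (A \<times> B \<union> B \<times> A) \<le> card (?M \<times> ?M)"
    using card_inj_on_le inj_on_subset[OF inj_on_midpoint_pair sub] fin by blast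
  then show ?thesis by (simp add: card_cartesian_product power2_eq_square)
qed

section \<open>The diameter bound\<close>

text \<open>Each stage contributes at most one factor, and the stage of the point 1 none, as a
  permutation of a single point is trivial.\<close>

lemma swap_length_Suc_le:
  "c permutes {1..Suc n} \<Longrightarrow> swap_length (Suc n) c \<le> n"
proof (induction n arbitrary: c)
  case 0
  then have "c 1 = 1"
    using permutes_superset[of c "{1}" "{}"] permutes_in_image[of c "{1}" 1] by (simp add: One_nat_def)
  then show ?case by (simp add: One_nat_def)
next
  case (Suc n)
  have "swap_length (Suc (Suc n)) c \<le> 1 + swap_length (Suc n) (c \<circ> last_swap (Suc (Suc n)) c)"
    by (subst swap_length.simps(2)) simp
  then show ?case using Suc.IH[OF comp_last_swap_permutes[OF Suc.prems]] by linarith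
qed

lemma sdist_le_pred:
  assumes "n \<ge> 1" "a \<in> Sym n" "b \<in> Sym n"
  shows "sdist n a b \<le> n - 1"
  using assms swap_length_Suc_le[of "inv a \<circ> b" "n - 1"] inv_comp_permutes[OF assms(2,3)]
  by (simp add: sdist_eq_swap_length)

lemma set_sdist_le:
  assumes "A \<subseteq> Sym n" "B \<subseteq> Sym n" "a \<in> A" "b \<in> B"
  shows "set_sdist n A B \<le> sdist n a b"
proof -
  have "{sdist n a b | a b. a \<in> A \<and> b \<in> B} = (\<lambda>(a, b). sdist n a b) ` (A \<times> B)" by auto
  moreover have "finite (A \<times> B)" using assms finite_subset[OF _ finite_Sym] by auto
  ultimately show ?thesis unfolding set_sdist_def using assms by (intro Min_le) auto
qed

section \<open>From cardinalities to logarithms\<close>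

theorem theorem4p2:
  fixes n :: nat and A B :: "(nat \<Rightarrow> nat) set" and K :: real
  assumes "n \<ge> 2"
    and "A \<subseteq> Sym n" and "A \<noteq> {}"
    and "B \<subseteq> Sym n" and "B \<noteq> {}"
    and "K = 4 * ln 2 / (real n - 1)^2"
  shows "ln (real (card (midpoint_set n A B)))
           \<ge> 1/2 * ln (real (card A)) + 1/2 * ln (real (card B))
             + K / 8 * (real (set_sdist n A B))^2"
proof -
  let ?m = "card (midpoint_set n A B)" and ?d = "set_sdist n A B"
  obtain a b where ab: "a \<in> A" "b \<in> B" using assms by blast
  have fin: "finite A" "finite B" using assms finite_subset[OF _ finite_Sym] by auto
  then have pos: "card A > 0" "card B > 0" using assms by (simp_all add: card_gt_0_iff)
  have card_le: "card (A \<times> B \<union> B \<times> A) \<le> ?m\<^sup>2"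
    using assms by (intro card_product_le_card_midpoint_set)
  have "card (A \<times> B) \<le> card (A \<times> B \<union> B \<times> A)" using fin by (intro card_mono) auto
  then have one: "card A * card B \<le> ?m\<^sup>2" using card_le by (simp add: card_cartesian_product)
  then have m: "?m > 0" using pos by (metis gr0I mult_eq_0_iff not_le zero_power2 not_gr_zero)
  \<comment> \<open>Applied with \<open>x = 1\<close> if the sets have distance 0, and with
    \<open>x = 2\<close> otherwise.\<close>
  have ln_le: "ln x + ln (real (card A)) + ln (real (card B)) \<le> 2 * ln (real ?m)"
    if "x > 0" "x * real (card A * card B) \<le> real (?m\<^sup>2)" for x :: real
  proof -
    have "ln (x * real (card A * card B)) \<le> ln (real (?m\<^sup>2))"
      using that pos m by (subst ln_le_cancel_iff) auto
    then show ?thesis using that pos m by (simp add: ln_mult ln_realpow)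
  qed
  \<comment> \<open>In this form the curvature term is at most \<open>ln 2 / 2\<close> as soon as
    the distance is at most \<open>n - 1\<close>; this is half the logarithm of the factor
    2.\<close>
  have K: "K / 8 * (real ?d)^2 = 1/2 * ln 2 * (real ?d / (real n - 1))^2"
    using assms(6) by (simp add: power_divide)
  show ?thesis
  proof (cases "?d = 0")
    case True
    have "1 * real (card A * card B) \<le> real (?m\<^sup>2)"
      using one by (simp only: mult_1 of_nat_le_iff)
    from ln_le[OF _ this] show ?thesis using True by simp
  next
    case False
    \<comment> \<open>A common point would be at distance 0 from itself.\<close>
    have "A \<inter> B = {}"
    proof (rule ccontr)
      assume "A \<inter> B \<noteq> {}"
      then obtain x where "x \<in> A" "x \<in> B" by blast
      then have "?d \<le> sdist n x x" using assms by (intro set_sdist_le)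
      moreover have "sdist n x x = 0" using sdist_le[of x x 0 n] by simp
      ultimately show False using False by simp
    qed
    then have "card (A \<times> B \<union> B \<times> A) = 2 * (card A * card B)"
      using fin by (subst card_Un_disjoint) (auto simp: card_cartesian_product)
    then have "2 * (card A * card B) \<le> ?m\<^sup>2" using card_le by simp
    then have "2 * real (card A * card B) \<le> real (?m\<^sup>2)"
      by (metis of_nat_le_iff of_nat_mult of_nat_numeral)
    from ln_le[OF _ this] have two: "ln 2 + ln (real (card A)) + ln (real (card B)) \<le> 2 * ln (real ?m)"
      by simp
    have "?d \<le> n - 1"
      using set_sdist_le[OF assms(2,4) ab] sdist_le_pred[of n a b] assms ab by fastforce
    then have "real ?d / (real n - 1) \<le> 1" using assms(1) by simp
    then have "(real ?d / (real n - 1))^2 \<le> 1" using assms(1) by (intro power_le_one) auto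
    then have "1/2 * ln 2 * (real ?d / (real n - 1))^2 \<le> 1/2 * ln (2::real)"
      by (intro mult_left_le) auto
    then show ?thesis using two K by linarith
  qed
qed

end
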